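(* Let $V$ be a vector space equipped with an injective linear map $Y(\cdot,x):V\to(\mathrm{End}\,V)[[x,x^{-1}]]$, $v\mapsto Y(v,x)=\sum_{n\in\mathbb Z}v_nx^{-n-1}$, such that $Y(u,x)v\in V((x))$ for all $u,v\in V$. Consider the properties: (WC, weak commutativity) for all $u,v\in V$ there exists an integer $m\ge0$ such that $(x_1-x_2)^{m}\left(Y(u,x_1)Y(v,x_2)-Y(v,x_2)Y(u,x_1)\right)=0$; (WA, weak associativity) for all $u,v,w\in V$ there exists an integer $m\ge0$ such that $(x_0+x_2)^{m}\left(Y(u,x_0+x_2)Y(v,x_2)w-Y(Y(u,x_0)v,x_2)w\right)=0$; (WSA, weak skew-associativity) for all $u,v,w\in V$ there exists an integer $m\ge0$ such that $(x_1-x_0)^{m}\left(Y(v,-x_0+x_1)Y(u,x_1)w-Y(Y(u,x_0)v,x_1-x_0)w\right)=0$. Then any two of (WC), (WA), (WSA) can replace the Jacobi identity in the definition of vacuum-free vertex algebra; that is, for each choice of two of these three properties, the two chosen properties both hold if and only if the Jacobi identity holds: for all $u,v\in V$, $$x_0^{-1}\delta\left(\frac{x_1-x_2}{x_0}\right)Y(u,x_1)Y(v,x_2)-x_0^{-1}\delta\left(\frac{-x_2+x_1}{x_0}\right)Y(v,x_2)Y(u,x_1)=x_1^{-1}\delta\left(\frac{x_2+x_0}{x_1}\right)Y(Y(u,x_0)v,x_2).$$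
   Context: All vector spaces are over $\mathbb C$; formal variables commute. For a vector space $U$, $U[[x,x^{-1}]]$ is the space of all formal Laurent series $\sum_{n\in\mathbb Z}u_nx^n$ with $u_n\in U$; $U((x))$ is the subspace of series with $u_n=0$ for $n$ sufficiently negative. $\delta(x)=\sum_{n\in\mathbb Z}x^n$. Binomial expansion convention: for every $n\in\mathbb Z$, $(x+y)^n=\sum_{k\ge0}\binom nk x^{n-k}y^k$, i.e. binomials are expanded in nonnegative powers of the second-listed variable (likewise with signs, so $(x_1-x_2)^n$ is expanded in nonnegative powers of $x_2$ and $(-x_2+x_1)^n$ in nonnegative powers of $x_1$); this applies inside $\delta$ and to substitutions such as $F(x+y)$. The map $Y$ is extended coefficientwise to series: $Y(Y(u,x_0)v,x_2)=\sum_n Y(u_nv,x_2)x_0^{-n-1}$. A vacuum-free vertex algebra is a vector space $V$ with an injective linear map $Y(\cdot,x):V\to(\mathrm{End}\,V)[[x,x^{-1}]]$ such that $Y(u,x)v\in V((x))$ for all $u,v\in V$ and the Jacobi identity (displayed in the claim) holds for all $u,v\in V$. *)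

theory Defs
  imports
    Complex_Main
    "HOL-Library.Function_Algebras"
    "HOL-Library.Groups_Big_Fun"
begin

text \<open>
  A formal series in commuting variables indexed by \<open>'i\<close>, with coefficients in \<open>'a\<close> and
  arbitrary integer exponents, is its coefficient function: \<open>F e\<close> is the coefficient of the
  monomial with exponent vector \<open>e\<close>.  Addition and subtraction are pointwise.

  Infinite sums of series are taken coefficientwise with \<open>Sum_any\<close>, which is the algebraic sum
  when only finitely many terms are nonzero (and \<open>0\<close> otherwise).  Every sum below that enters
  the axioms of a \<open>vertex_operator_map\<close> or the properties stated for it has finite support,
  thanks to the truncation condition and the expansion convention.
\<close>

type_synonym ('i, 'a) fseries = "('i \<Rightarrow> int) \<Rightarrow> 'a"

datatype fvar = X0 | X1 | X2

definition var_pow :: "'i \<Rightarrow> int \<Rightarrow> ('i, complex) fseries" where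
  "var_pow i n = (\<lambda>e. if e = (\<lambda>k. if k = i then n else 0) then 1 else 0)"

text \<open>
  \<open>(a x\<^sub>i + b x\<^sub>j)\<^sup>n = (\<Sum>k\<ge>0. (n choose k) (a x\<^sub>i)\<^sup>n\<^sup>-\<^sup>k (b x\<^sub>j)\<^sup>k)\<close> for distinct \<open>i\<close>, \<open>j\<close> and any integer \<open>n\<close>,
  expanded in nonnegative powers of the second-listed variable \<open>x\<^sub>j\<close>.
\<close>

definition binom_pow :: "complex \<Rightarrow> 'i \<Rightarrow> complex \<Rightarrow> 'i \<Rightarrow> int \<Rightarrow> ('i, complex) fseries" where
  "binom_pow a i b j n = (\<lambda>e.
     if (\<forall>k. k \<noteq> i \<and> k \<noteq> j \<longrightarrow> e k = 0) \<and> e i + e j = n \<and> e j \<ge> 0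
     then (of_int n gchoose nat (e j)) * a powi (e i) * b ^ nat (e j)
     else 0)"

abbreviation plus_pow :: "'i \<Rightarrow> 'i \<Rightarrow> int \<Rightarrow> ('i, complex) fseries"
  where "plus_pow i j \<equiv> binom_pow 1 i 1 j"          \<comment> \<open>\<open>(x\<^sub>i + x\<^sub>j)\<^sup>n\<close>\<close>

abbreviation minus_pow :: "'i \<Rightarrow> 'i \<Rightarrow> int \<Rightarrow> ('i, complex) fseries"
  where "minus_pow i j \<equiv> binom_pow 1 i (-1) j"      \<comment> \<open>\<open>(x\<^sub>i - x\<^sub>j)\<^sup>n\<close>\<close>

abbreviation neg_plus_pow :: "'i \<Rightarrow> 'i \<Rightarrow> int \<Rightarrow> ('i, complex) fseries"
  where "neg_plus_pow i j \<equiv> binom_pow (-1) i 1 j"   \<comment> \<open>\<open>(- x\<^sub>i + x\<^sub>j)\<^sup>n\<close>\<close>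

definition series_mult ::
  "(complex \<Rightarrow> 'a \<Rightarrow> 'a) \<Rightarrow> ('i, complex) fseries \<Rightarrow> ('i, 'a::comm_monoid_add) fseries \<Rightarrow> ('i, 'a) fseries"
  where "series_mult scale A F = (\<lambda>e. Sum_any (\<lambda>d. scale (A d) (F (e - d))))"

text \<open>
  \<open>x\<^sub>k\<^sup>-\<^sup>1 \<delta>(z / x\<^sub>k)\<close> with \<open>\<delta>(x) = (\<Sum>n. x\<^sup>n)\<close>, where \<open>P n\<close> is the expansion of \<open>z\<^sup>n\<close>.
\<close>

definition delta_quot :: "'i \<Rightarrow> (int \<Rightarrow> ('i, complex) fseries) \<Rightarrow> ('i, complex) fseries" where
  "delta_quot k P =
     series_mult (*) (var_pow k (-1))
       (\<lambda>e. Sum_any (\<lambda>n. series_mult (*) (var_pow k (- n)) (P n) e))"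

definition lower_truncated :: "(int \<Rightarrow> 'a::zero) \<Rightarrow> bool" where
  "lower_truncated f \<longleftrightarrow> (\<exists>N. \<forall>n<N. f n = 0)"

text \<open>
  \<open>Y v p\<close> is the coefficient of \<open>x\<^sup>p\<close> in \<open>Y(v,x)\<close>; in terms of modes,
  \<open>v\<^sub>n\<close> is \<open>Y v (- n - 1)\<close>.
\<close>

locale vertex_operator_map = vector_space scale
  for scale :: "complex \<Rightarrow> 'v::ab_group_add \<Rightarrow> 'v" +
  fixes Y :: "'v \<Rightarrow> int \<Rightarrow> 'v \<Rightarrow> 'v"
  assumes linear_op: "\<And>v p. Vector_Spaces.linear scale scale (Y v p)"
    and linear_Y: "\<And>p w. Vector_Spaces.linear scale scale (\<lambda>v. Y v p w)"
    and inj_Y: "inj Y"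
    and truncation: "\<And>u v. lower_truncated (\<lambda>p. Y u p v)"

text \<open>
  \<open>Y(u,z)\<close> for a formal argument \<open>z\<close> given by its (expanded) integer powers \<open>P n = z\<^sup>n\<close>;
  \<open>z = x\<^sub>i\<close> is \<open>P = var_pow i\<close>.
\<close>

definition vop ::
  "(complex \<Rightarrow> 'v \<Rightarrow> 'v) \<Rightarrow> ('v \<Rightarrow> int \<Rightarrow> 'v \<Rightarrow> 'v) \<Rightarrow> 'v \<Rightarrow> (int \<Rightarrow> ('i, complex) fseries)
     \<Rightarrow> ('i, 'v::ab_group_add \<Rightarrow> 'v) fseries"
  where "vop scale Y u P = (\<lambda>e w. Sum_any (\<lambda>n. scale (P n e) (Y u n w)))"

text \<open>
  Identities between \<open>End V\<close>-valued series are expressed by applying both sides to every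
  vector \<open>w\<close>.  \<open>vop_prod\<close> is \<open>Y(u,z)Y(v,z')w\<close>, and \<open>vop_iter\<close> is
  \<open>Y(Y(u,x\<^sub>i)v,z)w\<close>, that is \<open>\<Sum>p. x\<^sub>i\<^sup>p Y(a\<^sub>p,z)w\<close> for \<open>Y(u,x)v = (\<Sum>p. a\<^sub>p x\<^sup>p)\<close>.
\<close>

definition vop_prod ::
  "(complex \<Rightarrow> 'v \<Rightarrow> 'v) \<Rightarrow> ('v \<Rightarrow> int \<Rightarrow> 'v \<Rightarrow> 'v) \<Rightarrow> 'v \<Rightarrow> (int \<Rightarrow> ('i, complex) fseries)
     \<Rightarrow> 'v \<Rightarrow> (int \<Rightarrow> ('i, complex) fseries) \<Rightarrow> 'v \<Rightarrow> ('i, 'v::ab_group_add) fseries"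
  where "vop_prod scale Y u P v Q w =
    (\<lambda>e. Sum_any (\<lambda>d. vop scale Y u P d (vop scale Y v Q (e - d) w)))"

definition vop_iter ::
  "(complex \<Rightarrow> 'v \<Rightarrow> 'v) \<Rightarrow> ('v \<Rightarrow> int \<Rightarrow> 'v \<Rightarrow> 'v) \<Rightarrow> 'v \<Rightarrow> 'i
     \<Rightarrow> 'v \<Rightarrow> (int \<Rightarrow> ('i, complex) fseries) \<Rightarrow> 'v \<Rightarrow> ('i, 'v::ab_group_add) fseries"
  where "vop_iter scale Y u i v P w =
    (\<lambda>e. Sum_any (\<lambda>p. series_mult scale (var_pow i p) (\<lambda>d. vop scale Y (Y u p v) P d w) e))"

definition weak_commutativity ::
  "(complex \<Rightarrow> 'v::ab_group_add \<Rightarrow> 'v) \<Rightarrow> ('v \<Rightarrow> int \<Rightarrow> 'v \<Rightarrow> 'v) \<Rightarrow> bool"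
  where "weak_commutativity scale Y \<longleftrightarrow>
    (\<forall>u v. \<exists>m::nat. \<forall>w.
       series_mult scale (minus_pow X1 X2 (int m))
         (vop_prod scale Y u (var_pow X1) v (var_pow X2) w
          - vop_prod scale Y v (var_pow X2) u (var_pow X1) w) = 0)"

definition weak_associativity ::
  "(complex \<Rightarrow> 'v::ab_group_add \<Rightarrow> 'v) \<Rightarrow> ('v \<Rightarrow> int \<Rightarrow> 'v \<Rightarrow> 'v) \<Rightarrow> bool"
  where "weak_associativity scale Y \<longleftrightarrow>
    (\<forall>u v w. \<exists>m::nat.
       series_mult scale (plus_pow X0 X2 (int m))
         (vop_prod scale Y u (plus_pow X0 X2) v (var_pow X2) w
          - vop_iter scale Y u X0 v (var_pow X2) w) = 0)"

definition weak_skew_associativity ::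
  "(complex \<Rightarrow> 'v::ab_group_add \<Rightarrow> 'v) \<Rightarrow> ('v \<Rightarrow> int \<Rightarrow> 'v \<Rightarrow> 'v) \<Rightarrow> bool"
  where "weak_skew_associativity scale Y \<longleftrightarrow>
    (\<forall>u v w. \<exists>m::nat.
       series_mult scale (minus_pow X1 X0 (int m))
         (vop_prod scale Y v (neg_plus_pow X0 X1) u (var_pow X1) w
          - vop_iter scale Y u X0 v (minus_pow X1 X0) w) = 0)"

definition jacobi_identity ::
  "(complex \<Rightarrow> 'v::ab_group_add \<Rightarrow> 'v) \<Rightarrow> ('v \<Rightarrow> int \<Rightarrow> 'v \<Rightarrow> 'v) \<Rightarrow> bool"
  where "jacobi_identity scale Y \<longleftrightarrow>
    (\<forall>u v w.
       series_mult scale (delta_quot X0 (minus_pow X1 X2))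
         (vop_prod scale Y u (var_pow X1) v (var_pow X2) w)
       - series_mult scale (delta_quot X0 (neg_plus_pow X2 X1))
         (vop_prod scale Y v (var_pow X2) u (var_pow X1) w)
       = series_mult scale (delta_quot X1 (plus_pow X2 X0))
         (vop_iter scale Y u X0 v (var_pow X2) w))"

end

theory Submission
  imports Defs "HOL-Computational_Algebra.Formal_Power_Series"
begin

text \<open>
  Fix \<open>u\<close>, \<open>v\<close>, \<open>w\<close>, apply both sides of the Jacobi identity to \<open>w\<close>, and let \<open>j a b c\<close> (the
  \<open>defect\<close>) be the coefficient of \<open>x\<^sub>0\<^sup>a x\<^sub>1\<^sup>b x\<^sub>2\<^sup>c\<close> in the left side minus the right side.  All three
  delta functions live on the plane \<open>x\<^sub>0 = x\<^sub>1 - x\<^sub>2\<close>: multiplication by \<open>x\<^sub>0 - x\<^sub>1 + x\<^sub>2\<close>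
  annihilates each of them.  Hence \<open>j (a - 1) b c = j a (b - 1) c - j a b (c - 1)\<close>
  (\<open>defect_recurrence\<close>).

  Each weak property is a statement about one sufficiently negative layer of \<open>j\<close>.  The coefficient
  of \<open>x\<^sub>0\<^sup>-\<^sup>1\<^sup>-\<^sup>m\<close> in the two terms on the left is \<open>(x\<^sub>1 - x\<^sub>2)\<^sup>m\<close> times the commutator, and the right
  side contributes nothing to it for large \<open>m\<close> because \<open>Y(u,x\<^sub>0)v\<close> is lower truncated.  In the same
  way the coefficients of \<open>x\<^sub>1\<^sup>-\<^sup>1\<^sup>-\<^sup>m\<close> and \<open>x\<^sub>2\<^sup>-\<^sup>1\<^sup>-\<^sup>m\<close> express weak associativity and weak
  skew-associativity, the missing term being killed by the truncation of \<open>Y(u,x\<^sub>1)w\<close> and of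
  \<open>Y(v,x\<^sub>2)w\<close>.  The recurrence carries a layer of zeros to all lower layers, so the three
  properties say that \<open>j\<close> vanishes on a half space \<open>a < M\<close>, \<open>b < M\<close> or \<open>c < M\<close>
  (\<open>weak_commutativity_iff_defect\<close> and its two companions).

  Finally, a solution of the recurrence that vanishes on two such half spaces vanishes
  everywhere: solving for the entry that is shifted in the third direction expresses \<open>j\<close> through values
  closer to the two half spaces (\<open>vanishing_from_two_directions\<close>).  The Jacobi identity says
  precisely \<open>j = 0\<close>.
\<close>

section \<open>Algebraic infinite sums\<close>

text \<open>
  An infinite support is infinite after reindexing too, and both sums are then \<open>0\<close>.  So coefficients can be rewritten before any truncation argument.
\<close>

lemma Sum_any_reindex_superset:
  assumes "inj h" and "\<And>x. f x \<noteq> 0 \<Longrightarrow> x \<in> range h"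
  shows "Sum_any f = Sum_any (\<lambda>k. f (h k))"
proof -
  have *: "{x. f x \<noteq> 0} = h ` {k. f (h k) \<noteq> 0}"
    using assms(2) by blast
  show ?thesis
    unfolding Sum_any.expand_set * using assms(1)
    by (simp add: sum.reindex inj_on_subset)
qed

lemma Sum_any_single:
  assumes "\<And>x. x \<noteq> a \<Longrightarrow> f x = 0"
  shows "Sum_any f = f a"
  using Sum_any.expand_superset[of "{a}" f] assms by auto

lemma Sum_any_atMost:
  fixes f :: "nat \<Rightarrow> 'b::comm_monoid_add"
  assumes "\<And>k. k > M \<Longrightarrow> f k = 0"
  shows "Sum_any f = sum f {..M}"
  using Sum_any.expand_superset[of "{..M}" f] assms not_le_imp_less by auto

section \<open>Propagation of zeros in the exponent lattice\<close>

text \<open>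
  Here \<open>g - h\<close> plays the defect, \<open>g\<close> the two terms that enter a weak property and \<open>h\<close> the third
  term.  The layers \<open>- 1 - m\<close> with \<open>m\<close> natural are cofinal downwards, so a deep enough one lies below
  the truncation of \<open>h\<close>.  The parameter \<open>'w\<close> is for weak commutativity, whose
  exponent must be uniform in the vector acted on.
\<close>

lemma vanishing_layer_iff:
  fixes g h :: "'w \<Rightarrow> int \<Rightarrow> int \<Rightarrow> int \<Rightarrow> 'b::ab_group_add"
  assumes step: "\<And>w x. (\<And>y z. g w x y z = 0) \<Longrightarrow> (\<And>y z. g w (x - 1) y z = 0)"
    and h: "\<exists>N. \<forall>w. \<forall>x<N. \<forall>y z. h w x y z = 0"
  shows "(\<exists>m::nat. \<forall>w y z. g w (- 1 - int m) y z = 0)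
     \<longleftrightarrow> (\<exists>M. \<forall>w. \<forall>x<M. \<forall>y z. g w x y z - h w x y z = 0)"
proof -
  from h obtain N where N: "\<And>w x y z. x < N \<Longrightarrow> h w x y z = 0"
    by blast
  show ?thesis
  proof
    assume "\<exists>m::nat. \<forall>w y z. g w (- 1 - int m) y z = 0"
    then obtain m :: nat where m: "\<And>w y z. g w (- 1 - int m) y z = 0"
      by blast
    have "g w x y z = 0" if "x \<le> - 1 - int m" for w x y z
      using that
    proof (induction x arbitrary: y z rule: int_le_induct)
      case base
      show ?case by (rule m)
    next
      case (step x)
      then show ?case by (intro assms(1))
    qed
    then have "\<forall>w. \<forall>x<min N (- int m). \<forall>y z. g w x y z - h w x y z = 0"
      using N by simp
    then show "\<exists>M. \<forall>w. \<forall>x<M. \<forall>y z. g w x y z - h w x y z = 0"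
      by blast
  next
    assume "\<exists>M. \<forall>w. \<forall>x<M. \<forall>y z. g w x y z - h w x y z = 0"
    then obtain M where M: "\<And>w x y z. x < M \<Longrightarrow> g w x y z - h w x y z = 0"
      by blast
    define m where "m = nat (- min M N)"
    have "- 1 - int m < M" "- 1 - int m < N"
      unfolding m_def by auto
    then have "g w (- 1 - int m) y z = 0" for w y z
      using M N by fastforce
    then show "\<exists>m::nat. \<forall>w y z. g w (- 1 - int m) y z = 0"
      by blast
  qed
qed

text \<open>
  Both predecessors in \<open>step\<close> have smaller \<open>x + y\<close>, which is bounded below outside the two half
  spaces; the third coordinate is unconstrained, so its shift does no harm.
\<close>

lemma vanishing_from_two_directions:
  fixes j :: "int \<Rightarrow> int \<Rightarrow> int \<Rightarrow> 'b::zero"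
  assumes step: "\<And>x y z. j (x - 1) y (z + 1) = 0 \<Longrightarrow> j x (y - 1) (z + 1) = 0 \<Longrightarrow> j x y z = 0"
    and x: "\<And>x y z. x < M \<Longrightarrow> j x y z = 0" and y: "\<And>x y z. y < N \<Longrightarrow> j x y z = 0"
  shows "j x y z = 0"
proof (induction "nat (x - M) + nat (y - N)" arbitrary: x y z rule: less_induct)
  case less
  show ?case
  proof (cases "x < M \<or> y < N")
    case False
    show ?thesis
    proof (rule step)
      show "j (x - 1) y (z + 1) = 0"
        using False less[of "x - 1" y] x by (cases "x = M") auto
      show "j x (y - 1) (z + 1) = 0"
        using False less[of x "y - 1"] y by (cases "y = N") auto
    qed
  qed (use x y in blast)
qed

section \<open>Coefficients of delta function products\<close>

locale complex_space = vector_space scale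
  for scale :: "complex \<Rightarrow> 'v::ab_group_add \<Rightarrow> 'v"
begin

text \<open>
  The coefficient of \<open>x\<^sub>0\<^sup>a x\<^sub>1\<^sup>b x\<^sub>2\<^sup>c\<close> in \<open>x\<^sub>0\<^sup>-\<^sup>1 \<delta>((x\<^sub>1 - s x\<^sub>2)/x\<^sub>0) f(x\<^sub>1,x\<^sub>2)\<close>, where \<open>f p q\<close> is the
  coefficient of \<open>x\<^sub>1\<^sup>p x\<^sub>2\<^sup>q\<close>.  The binomial coefficients \<open>(- 1 - a) gchoose k\<close> of the delta function
  are written with negated upper index.  In this form the sum is also the coefficient in
  \<open>x\<^sub>1\<^sup>-\<^sup>1 \<delta>((x\<^sub>0 + s x\<^sub>2)/x\<^sub>1) f(x\<^sub>0 + s x\<^sub>2,x\<^sub>2)\<close>, which is what links the Jacobi identity to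
  the weak associativities.
\<close>

definition delta_coeff :: "complex \<Rightarrow> (int \<Rightarrow> int \<Rightarrow> 'v) \<Rightarrow> int \<Rightarrow> int \<Rightarrow> int \<Rightarrow> 'v" where
  "delta_coeff s f a b c =
     Sum_any (\<lambda>k. scale (s ^ k * (of_int (a + int k) gchoose k)) (f (a + b + 1 + int k) (c - int k)))"

text \<open>
  The coefficient of \<open>x\<^sup>r y\<^sup>t\<close> in \<open>f(\<alpha> x + \<beta> y, y)\<close>.
\<close>

definition subst_binom :: "complex \<Rightarrow> complex \<Rightarrow> (int \<Rightarrow> int \<Rightarrow> 'v) \<Rightarrow> int \<Rightarrow> int \<Rightarrow> 'v" where
  "subst_binom \<alpha> \<beta> f r t =
     Sum_any (\<lambda>k. scale ((of_int (r + int k) gchoose k) * \<alpha> powi r * \<beta> ^ k) (f (r + int k) (t - int k)))"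

definition truncated_in_second :: "(int \<Rightarrow> int \<Rightarrow> 'v) \<Rightarrow> bool" where
  "truncated_in_second f \<longleftrightarrow> (\<exists>N. \<forall>x. \<forall>y<N. f x y = 0)"

lemma delta_coeff_eq_sum:
  assumes "\<forall>x. \<forall>y<N. f x y = 0" and "c - N \<le> int M"
  shows "delta_coeff s f a b c =
    (\<Sum>k\<le>M. scale (s ^ k * (of_int (a + int k) gchoose k)) (f (a + b + 1 + int k) (c - int k)))"
  unfolding delta_coeff_def by (rule Sum_any_atMost) (use assms in auto)

lemma delta_coeff_below_truncation:
  assumes "\<forall>x. \<forall>y<N. f x y = 0" and "c < N"
  shows "delta_coeff s f a b c = 0"
  using assms by (auto simp: delta_coeff_def)

text \<open>
  This is Pascal's rule; it expresses that \<open>x\<^sub>0 - x\<^sub>1 + s x\<^sub>2\<close> annihilates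
  \<open>x\<^sub>0\<^sup>-\<^sup>1 \<delta>((x\<^sub>1 - s x\<^sub>2)/x\<^sub>0)\<close>.  Truncation makes the sums finite, so that they can be shifted and
  subtracted.
\<close>

lemma delta_coeff_recurrence:
  assumes "truncated_in_second f"
  shows "delta_coeff s f (a - 1) b c = delta_coeff s f a (b - 1) c - scale s (delta_coeff s f a b (c - 1))"
proof -
  from assms obtain N where N: "\<forall>x. \<forall>y<N. f x y = 0"
    unfolding truncated_in_second_def by blast
  define M where "M = nat (c - N)"
  let ?g = "\<lambda>k. f (a + b + int k) (c - int k)"
  have L: "delta_coeff s f (a - 1) b c =
      (\<Sum>k\<le>Suc M. scale (s ^ k * (of_int (a - 1 + int k) gchoose k)) (?g k))"
    by (subst delta_coeff_eq_sum[OF N, of _ "Suc M"]) (auto simp: M_def)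
  have R1: "delta_coeff s f a (b - 1) c =
      (\<Sum>k\<le>Suc M. scale (s ^ k * (of_int (a + int k) gchoose k)) (?g k))"
    by (subst delta_coeff_eq_sum[OF N, of _ "Suc M"]) (auto simp: M_def)
  have R2: "scale s (delta_coeff s f a b (c - 1)) =
      (\<Sum>k\<le>M. scale (s ^ Suc k * (of_int (a + int k) gchoose k)) (?g (Suc k)))"
    by (subst delta_coeff_eq_sum[OF N, of _ "M"])
      (auto simp: M_def scale_sum_right algebra_simps)
  have P: "(of_int (a + int (Suc k)) gchoose Suc k) - (of_int (a + int k) gchoose k)
      = (of_int (a - 1 + int (Suc k)) gchoose Suc k :: complex)" for k
    using gbinomial_addition_formula[of "of_int (a + int (Suc k)) :: complex" k]
    by (simp add: algebra_simps)
  have S: "scale (s ^ Suc k * (of_int (a - 1 + int (Suc k)) gchoose Suc k)) (?g (Suc k))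
      = scale (s ^ Suc k * (of_int (a + int (Suc k)) gchoose Suc k)) (?g (Suc k))
      - scale (s ^ Suc k * (of_int (a + int k) gchoose k)) (?g (Suc k))" for k
    unfolding P[symmetric] by (simp only: scale_left_diff_distrib right_diff_distrib)
  show ?thesis
    unfolding L R1 R2 sum.atMost_Suc_shift S sum_subtractf by simp
qed

text \<open>
  The left side is a coefficient of \<open>(\<alpha> x + \<beta> y)\<^sup>n f(\<alpha> x + \<beta> y, y)\<close>, which is the substitution
  \<open>z = \<alpha> x + \<beta> y\<close> in \<open>z\<^sup>n f(z, y)\<close>.  Collecting the terms that involve the same
  coefficient of \<open>f\<close> turns this into Vandermonde's convolution.
\<close>

lemma mult_subst_binom:
  assumes "truncated_in_second f" and "\<alpha> \<noteq> 0"
  shows "Sum_any (\<lambda>j. scale ((of_int n gchoose j) * \<alpha> powi (n - int j) * \<beta> ^ j)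
            (subst_binom \<alpha> \<beta> f (r - n + int j) (t - int j)))
       = scale (\<alpha> powi r) (delta_coeff \<beta> f r (- 1 - n) t)"
proof -
  from assms obtain N where N: "\<forall>x. \<forall>y<N. f x y = 0"
    unfolding truncated_in_second_def by blast
  define M where "M = nat (t - N)"
  have S: "subst_binom \<alpha> \<beta> f (r - n + int j) (t - int j) =
      (\<Sum>k\<le>M - j. scale ((of_int (r - n + int j + int k) gchoose k) * \<alpha> powi (r - n + int j) * \<beta> ^ k)
           (f (r - n + int j + int k) (t - int j - int k)))" for j
    unfolding subst_binom_def
    by (rule Sum_any_atMost) (use N in \<open>auto simp: M_def\<close>)
  have S0: "subst_binom \<alpha> \<beta> f (r - n + int j) (t - int j) = 0" if "j > M" for j
    unfolding subst_binom_def using N that by (auto simp: M_def)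
  let ?h = "\<lambda>j k. scale ((of_int n gchoose j) * \<alpha> powi r * \<beta> ^ (j + k)
                  * (of_int (r - n + int (j + k)) gchoose k)) (f (r - n + int (j + k)) (t - int (j + k)))"
  have pw: "\<alpha> powi (n - int j) * \<alpha> powi (r - n + int j) = \<alpha> powi r" for j
    using assms(2) by (simp flip: power_int_add)
  have "Sum_any (\<lambda>j. scale ((of_int n gchoose j) * \<alpha> powi (n - int j) * \<beta> ^ j)
            (subst_binom \<alpha> \<beta> f (r - n + int j) (t - int j)))
     = (\<Sum>j\<le>M. scale ((of_int n gchoose j) * \<alpha> powi (n - int j) * \<beta> ^ j)
            (subst_binom \<alpha> \<beta> f (r - n + int j) (t - int j)))"
    by (rule Sum_any_atMost) (simp add: S0)
  also have "\<dots> = (\<Sum>j\<le>M. \<Sum>k\<le>M - j. ?h j k)"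
    unfolding S scale_sum_right
  proof (intro sum.cong refl)
    fix j k
    have "((of_int n gchoose j) * \<alpha> powi (n - int j) * \<beta> ^ j)
        * ((of_int (r - n + int j + int k) gchoose k) * \<alpha> powi (r - n + int j) * \<beta> ^ k)
       = (of_int n gchoose j) * (\<alpha> powi (n - int j) * \<alpha> powi (r - n + int j)) * \<beta> ^ (j + k)
           * (of_int (r - n + int (j + k)) gchoose k)"
      by (simp add: power_add algebra_simps)
    then show "scale ((of_int n gchoose j) * \<alpha> powi (n - int j) * \<beta> ^ j)
        (scale ((of_int (r - n + int j + int k) gchoose k) * \<alpha> powi (r - n + int j) * \<beta> ^ k)
           (f (r - n + int j + int k) (t - int j - int k))) = ?h j k"
      unfolding pw by (simp add: algebra_simps)
  qed
  also have "\<dots> = (\<Sum>(j, k)\<in>{(j, k). j + k \<le> M}. ?h j k)"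
    by (subst sum.Sigma) (auto intro!: sum.cong)
  also have "\<dots> = (\<Sum>k\<le>M. \<Sum>j\<le>k. ?h j (k - j))"
    by (rule sum.triangle_reindex_eq)
  also have "\<dots> = (\<Sum>k\<le>M. scale (\<alpha> powi r * (\<beta> ^ k * (of_int (r + int k) gchoose k)))
                     (f (r + (- 1 - n) + 1 + int k) (t - int k)))"
  proof (rule sum.cong[OF refl])
    fix k
    have V: "(\<Sum>j\<le>k. (of_int n gchoose j) * (of_int (r - n + int k) gchoose (k - j)))
        = (of_int (r + int k) gchoose k :: complex)"
      using gbinomial_Vandermonde[of "of_int n :: complex" "of_int (r - n + int k)" k]
      by (simp add: atMost_atLeast0)
    have "(\<Sum>j\<le>k. ?h j (k - j)) = (\<Sum>j\<le>k. scale (\<alpha> powi r * (\<beta> ^ k *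
          ((of_int n gchoose j) * (of_int (r - n + int k) gchoose (k - j)))))
          (f (r + (- 1 - n) + 1 + int k) (t - int k)))"
      by (intro sum.cong refl) (simp add: algebra_simps)
    then show "(\<Sum>j\<le>k. ?h j (k - j)) = scale (\<alpha> powi r * (\<beta> ^ k * (of_int (r + int k) gchoose k)))
                     (f (r + (- 1 - n) + 1 + int k) (t - int k))"
      by (simp only: scale_sum_left[symmetric] sum_distrib_left[symmetric] V)
  qed
  also have "\<dots> = scale (\<alpha> powi r) (delta_coeff \<beta> f r (- 1 - n) t)"
    by (subst delta_coeff_eq_sum[OF N, of _ M]) (auto simp: M_def scale_sum_right)
  finally show ?thesis .
qed

text \<open>
  The left side is a coefficient of \<open>(\<alpha> (x - s y))\<^sup>n f(x, y)\<close>; negating the upper index of the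
  binomial coefficient exhibits it as the layer \<open>- 1 - n\<close> of the delta function product.
\<close>

lemma mult_binom_eq_delta_coeff:
  assumes "\<alpha> \<noteq> 0"
  shows "Sum_any (\<lambda>j. scale ((of_int n gchoose j) * \<alpha> powi (n - int j) * (- (\<alpha> * s)) ^ j)
            (f (r - n + int j) (t - int j)))
       = scale (\<alpha> powi n) (delta_coeff s f (- 1 - n) r t)"
proof -
  have coeff: "(of_int n gchoose j) * \<alpha> powi (n - int j) * (- (\<alpha> * s)) ^ j
      = \<alpha> powi n * (s ^ j * (of_int (- 1 - n + int j) gchoose j))" for j
  proof -
    let ?G = "of_int (- 1 - n + int j) gchoose j :: complex"
    have A: "of_int n gchoose j = (-1) ^ j * ?G"
      using gbinomial_negated_upper[of "of_int n :: complex" j] by (simp add: algebra_simps)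
    have B: "(- (\<alpha> * s)) ^ j = (-1) ^ j * (\<alpha> ^ j * s ^ j)"
      using power_mult_distrib[of "-1" "\<alpha> * s" j] by (simp add: power_mult_distrib)
    have C: "\<alpha> powi (n - int j) * \<alpha> ^ j = \<alpha> powi n"
      using assms by (simp add: power_int_diff)
    have D: "(-1) ^ j * (-1) ^ j = (1::complex)"
      by (simp flip: power_mult_distrib)
    have "(-1) ^ j * ?G * \<alpha> powi (n - int j) * ((-1) ^ j * (\<alpha> ^ j * s ^ j))
        = (\<alpha> powi (n - int j) * \<alpha> ^ j) * (((-1) ^ j * (-1) ^ j) * (s ^ j * ?G))"
      by (simp only: ac_simps)
    then show ?thesis
      unfolding A B C D by simp
  qed
  have pull: "Sum_any (\<lambda>j. scale (c * g j) (x j)) = scale c (Sum_any (\<lambda>j. scale (g j) (x j)))"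
    if "c \<noteq> 0" for c and g :: "nat \<Rightarrow> complex" and x
    unfolding Sum_any.expand_set scale_scale[symmetric] using that
    by (simp add: scale_sum_right)
  have nz: "\<alpha> powi n \<noteq> 0"
    using assms by simp
  have arg: "- 1 - n + r + 1 + int j = r - n + int j" for j
    by simp
  show ?thesis
    unfolding delta_coeff_def coeff pull[OF nz] arg ..
qed

end

section \<open>Products with binomial powers and delta functions\<close>

context complex_space
begin

definition bivariate :: "'i \<Rightarrow> 'i \<Rightarrow> (int \<Rightarrow> int \<Rightarrow> 'v) \<Rightarrow> ('i, 'v) fseries" where
  "bivariate i j f = (\<lambda>e. if \<forall>k. k \<noteq> i \<and> k \<noteq> j \<longrightarrow> e k = 0 then f (e i) (e j) else 0)"

lemma bivariate_swap: "bivariate i j f = bivariate j i (\<lambda>r t. f t r)"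
  by (auto simp: bivariate_def fun_eq_iff)

lemma bivariate_diff: "bivariate i j f - bivariate i j g = bivariate i j (\<lambda>r t. f r t - g r t)"
  by (auto simp: bivariate_def fun_eq_iff)

lemma bivariate_eq_0_iff:
  assumes "i \<noteq> j"
  shows "bivariate i j f = 0 \<longleftrightarrow> (\<forall>r t. f r t = 0)"
proof
  assume *: "bivariate i j f = 0"
  show "\<forall>r t. f r t = 0"
  proof (intro allI)
    fix r t
    show "f r t = 0"
      using assms fun_cong[OF *, of "\<lambda>k. if k = i then r else if k = j then t else 0"]
      by (simp add: bivariate_def)
  qed
qed (auto simp: bivariate_def fun_eq_iff)

lemma series_mult_binom_pow:
  assumes "i \<noteq> j"
  shows "series_mult scale (binom_pow \<alpha> i \<beta> j n) F e =
    Sum_any (\<lambda>k. scale ((of_int n gchoose k) * \<alpha> powi (n - int k) * \<beta> ^ k)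
      (F (e(i := e i - n + int k, j := e j - int k))))"
proof -
  define h where "h = (\<lambda>k::nat. \<lambda>l. if l = i then n - int k else if l = j then int k else 0)"
  have "inj h"
    using assms by (auto simp: inj_def h_def fun_eq_iff split: if_splits)
  moreover have "d \<in> range h" if "scale (binom_pow \<alpha> i \<beta> j n d) (F (e - d)) \<noteq> 0" for d
  proof -
    have "binom_pow \<alpha> i \<beta> j n d \<noteq> 0"
      using that by auto
    then have "d = h (nat (d j))"
      by (auto simp: binom_pow_def h_def fun_eq_iff split: if_splits)
    then show ?thesis
      by blast
  qed
  ultimately have "series_mult scale (binom_pow \<alpha> i \<beta> j n) F e
      = Sum_any (\<lambda>k. scale (binom_pow \<alpha> i \<beta> j n (h k)) (F (e - h k)))"
    unfolding series_mult_def by (rule Sum_any_reindex_superset)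
  moreover have "e - h k = e(i := e i - n + int k, j := e j - int k)" for k
    using assms by (auto simp: h_def fun_eq_iff)
  moreover have "binom_pow \<alpha> i \<beta> j n (h k) = (of_int n gchoose k) * \<alpha> powi (n - int k) * \<beta> ^ k" for k
    using assms by (simp add: binom_pow_def h_def)
  ultimately show ?thesis
    by simp
qed

text \<open>
  For nonnegative exponents the binomial series is finite, so the order of expansion is
  immaterial.  The factors that multiply the weak properties may therefore be expanded in whichever
  order the delta functions of the Jacobi identity use.
\<close>

lemma binom_pow_swap:
  fixes i j :: 'i
  assumes "i \<noteq> j"
  shows "binom_pow \<alpha> i \<beta> j (int m) = binom_pow \<beta> j \<alpha> i (int m)"
proof
  fix e :: "'i \<Rightarrow> int"
  have big: "(of_nat m gchoose nat q :: complex) = 0" if "q > int m" for q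
    using that by (simp flip: binomial_gbinomial)
  have sym: "(of_int (int m) gchoose nat q :: complex) = of_int (int m) gchoose nat p"
    if "p + q = int m" "p \<ge> 0" "q \<ge> 0" for p q
  proof -
    have "nat p = m - nat q" "nat q \<le> m"
      using that by auto
    then show ?thesis
      using gbinomial_of_nat_symmetric[of "nat q" m, where 'a = complex] by simp
  qed
  consider "e i + e j \<noteq> int m" | "e i + e j = int m" "e i < 0" | "e i + e j = int m" "e j < 0"
    | "e i + e j = int m" "e i \<ge> 0" "e j \<ge> 0"
    by linarith
  then show "binom_pow \<alpha> i \<beta> j (int m) e = binom_pow \<beta> j \<alpha> i (int m) e"
  proof cases
    case 4
    then show ?thesis
      using sym[of "e i" "e j"] by (auto simp: binom_pow_def power_int_nonneg_exp)
  qed (auto simp: binom_pow_def big)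
qed

text \<open>
  The general product is not additive in its second factor, since an infinite sum of coefficients is
  \<open>0\<close> by convention; here at most \<open>m + 1\<close> summands occur.
\<close>

lemma series_mult_binom_pow_diff:
  assumes "i \<noteq> j"
  shows "series_mult scale (binom_pow \<alpha> i \<beta> j (int m)) (F - G)
       = series_mult scale (binom_pow \<alpha> i \<beta> j (int m)) F - series_mult scale (binom_pow \<alpha> i \<beta> j (int m)) G"
proof
  fix e :: "_ \<Rightarrow> int"
  have finite_form: "series_mult scale (binom_pow \<alpha> i \<beta> j (int m)) H e =
    (\<Sum>k\<le>m. scale ((of_int (int m) gchoose k) * \<alpha> powi (int m - int k) * \<beta> ^ k)
      (H (e(i := e i - int m + int k, j := e j - int k))))" for H
    unfolding series_mult_binom_pow[OF assms]
    by (rule Sum_any_atMost) (simp flip: binomial_gbinomial)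
  show "series_mult scale (binom_pow \<alpha> i \<beta> j (int m)) (F - G) e
      = (series_mult scale (binom_pow \<alpha> i \<beta> j (int m)) F
          - series_mult scale (binom_pow \<alpha> i \<beta> j (int m)) G) e"
    by (simp add: finite_form scale_right_diff_distrib sum_subtractf)
qed

lemma series_mult_binom_pow_bivariate:
  assumes "i \<noteq> j"
  shows "series_mult scale (binom_pow \<alpha> i \<beta> j n) (bivariate i j f) = bivariate i j
    (\<lambda>r t. Sum_any (\<lambda>k. scale ((of_int n gchoose k) * \<alpha> powi (n - int k) * \<beta> ^ k)
       (f (r - n + int k) (t - int k))))"
proof
  fix e :: "_ \<Rightarrow> int"
  show "series_mult scale (binom_pow \<alpha> i \<beta> j n) (bivariate i j f) e = bivariate i j
    (\<lambda>r t. Sum_any (\<lambda>k. scale ((of_int n gchoose k) * \<alpha> powi (n - int k) * \<beta> ^ k)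
       (f (r - n + int k) (t - int k)))) e"
    by (cases "\<forall>k. k \<noteq> i \<and> k \<noteq> j \<longrightarrow> e k = 0")
      (use assms in \<open>simp_all add: series_mult_binom_pow bivariate_def del: not_all\<close>)
qed

lemma series_mult_binom_pow_delta_coeff:
  assumes "i \<noteq> j" "\<alpha> \<noteq> 0" "\<beta> = - (\<alpha> * s)"
  shows "series_mult scale (binom_pow \<alpha> i \<beta> j n) (bivariate i j f) = bivariate i j
    (\<lambda>r t. scale (\<alpha> powi n) (delta_coeff s f (- 1 - n) r t))"
  unfolding series_mult_binom_pow_bivariate[OF assms(1)] assms(3)
    mult_binom_eq_delta_coeff[OF assms(2)] ..

lemma series_mult_binom_pow_subst:
  assumes "i \<noteq> j" "\<alpha> \<noteq> 0" "truncated_in_second f"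
  shows "series_mult scale (binom_pow \<alpha> i \<beta> j n) (bivariate i j (subst_binom \<alpha> \<beta> f)) = bivariate i j
    (\<lambda>r t. scale (\<alpha> powi r) (delta_coeff \<beta> f r (- 1 - n) t))"
  unfolding series_mult_binom_pow_bivariate[OF assms(1)] mult_subst_binom[OF assms(3,2)] ..

lemma series_mult_var_pow:
  assumes "\<And>x. sc 0 x = 0" "\<And>x. sc 1 x = x"
  shows "series_mult sc (var_pow k m) F e = F (e(k := e k - m))"
proof -
  let ?d = "\<lambda>l. if l = k then m else 0"
  have "series_mult sc (var_pow k m) F e = sc (var_pow k m ?d) (F (e - ?d))"
    unfolding series_mult_def by (rule Sum_any_single) (simp add: var_pow_def assms(1))
  moreover have "e - ?d = e(k := e k - m)"
    by (auto simp: fun_eq_iff)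
  ultimately show ?thesis
    by (simp add: var_pow_def assms(2))
qed

text \<open>
  Only the summand \<open>n = - 1 - d k\<close> of the delta function has the exponent \<open>d k\<close> in the
  variable \<open>k\<close>.
\<close>

lemma delta_quot_coeff:
  assumes "\<And>n d. P n d \<noteq> 0 \<Longrightarrow> d k = 0"
  shows "delta_quot k P d = P (- 1 - d k) (d(k := 0))"
proof -
  have "Sum_any (\<lambda>n. series_mult (*) (var_pow k (- n)) (P n) e) = P (- e k) (e(k := 0))" for e
  proof -
    have "Sum_any (\<lambda>n. P n (e(k := e k + n))) = P (- e k) (e(k := e k + - e k))"
      using assms by (intro Sum_any_single) fastforce
    then show ?thesis
      by (simp add: series_mult_var_pow)
  qed
  then show ?thesis
    by (simp add: delta_quot_def series_mult_var_pow minus_diff_commute[of "d k" 1])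
qed

text \<open>
  When \<open>F\<close> does not involve the variable \<open>k\<close>, only the layer \<open>e k\<close> of the delta function contributes.
\<close>

lemma series_mult_delta_quot:
  assumes P: "\<And>n d. P n d \<noteq> 0 \<Longrightarrow> d k = 0" and F: "\<And>d. F d \<noteq> 0 \<Longrightarrow> d k = 0"
  shows "series_mult scale (delta_quot k P) F e = series_mult scale (P (- 1 - e k)) F (e(k := 0))"
proof -
  \<comment> \<open>The exponent of \<open>k\<close> in the delta function must be \<open>e k\<close>, on the other side it must be \<open>0\<close>;
    a translation matches the two and is a bijection on all exponents.\<close>
  define h where "h = (\<lambda>d. d(k := d k + e k))"
  have "inj h"
    by (auto simp: inj_def h_def fun_eq_iff split: if_splits)
  moreover have "d \<in> range h" for d
    by (rule range_eqI[of _ _ "d(k := d k - e k)"]) (simp add: h_def)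
  ultimately have "series_mult scale (delta_quot k P) F e
      = Sum_any (\<lambda>d. scale (delta_quot k P (h d)) (F (e - h d)))"
    unfolding series_mult_def by (intro Sum_any_reindex_superset) auto
  also have "\<dots> = series_mult scale (P (- 1 - e k)) F (e(k := 0))"
    unfolding series_mult_def
  proof (intro Sum_any.cong)
    fix d
    show "scale (delta_quot k P (h d)) (F (e - h d)) = scale (P (- 1 - e k) d) (F (e(k := 0) - d))"
    proof (cases "d k = 0")
      case True
      then have "d(k := 0) = d" "e - h d = e(k := 0) - d"
        by (auto simp: h_def fun_eq_iff)
      moreover have "delta_quot k P (h d) = P (- 1 - e k) d"
        using delta_quot_coeff[of P k "h d"] P \<open>d(k := 0) = d\<close> True by (simp add: h_def)
      ultimately show ?thesis
        by simp
    next
      case False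
      then have "F (e - h d) = 0" "P (- 1 - e k) d = 0"
        using F[of "e - h d"] P[of "- 1 - e k" d] by (auto simp: h_def)
      then show ?thesis
        by simp
    qed
  qed
  finally show ?thesis .
qed

lemma series_mult_delta_quot_binom:
  assumes "i \<noteq> j" "k \<noteq> i" "k \<noteq> j" "\<And>l. l = i \<or> l = j \<or> l = k" "\<alpha> \<noteq> 0" "\<beta> = - (\<alpha> * s)"
  shows "series_mult scale (delta_quot k (binom_pow \<alpha> i \<beta> j)) (bivariate i j f) e
       = scale (\<alpha> powi (- 1 - e k)) (delta_coeff s f (e k) (e i) (e j))"
proof -
  have "series_mult scale (delta_quot k (binom_pow \<alpha> i \<beta> j)) (bivariate i j f) e
      = series_mult scale (binom_pow \<alpha> i \<beta> j (- 1 - e k)) (bivariate i j f) (e(k := 0))"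
    using assms(2,3)
    by (intro series_mult_delta_quot) (auto simp: binom_pow_def bivariate_def split: if_splits)
  also have "\<dots> = scale (\<alpha> powi (- 1 - e k)) (delta_coeff s f (e k) (e i) (e j))"
    unfolding series_mult_binom_pow_delta_coeff[OF assms(1,5,6)]
    using assms(2,3,4) by (auto simp: bivariate_def)
  finally show ?thesis .
qed

end

section \<open>Products and iterates of vertex operators\<close>

context vertex_operator_map
begin

sublocale complex_space scale ..

lemma Y_zero_right [simp]: "Y u p 0 = 0"
  using linear_op[of u p] by (simp add: linear_iff_module_hom module_hom.zero)

lemma Y_zero_left [simp]: "Y 0 p w = 0"
  using module_hom.zero[of scale scale "\<lambda>v. Y v p w"] linear_Y by (simp add: linear_iff_module_hom)

lemma vop_var_pow:
  "vop scale Y u (var_pow i) e w = (if \<forall>k. k \<noteq> i \<longrightarrow> e k = 0 then Y u (e i) w else 0)"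
proof -
  have "vop scale Y u (var_pow i) e w = scale (var_pow i (e i) e) (Y u (e i) w)"
    unfolding vop_def by (rule Sum_any_single) (simp add: var_pow_def, metis)
  moreover have "e = (\<lambda>k. if k = i then e i else 0) \<longleftrightarrow> (\<forall>k. k \<noteq> i \<longrightarrow> e k = 0)"
    by (metis (full_types))
  ultimately show ?thesis
    by (auto simp: var_pow_def)
qed

lemma vop_binom_pow:
  "vop scale Y u (binom_pow \<alpha> i \<beta> j) e w =
    (if (\<forall>k. k \<noteq> i \<and> k \<noteq> j \<longrightarrow> e k = 0) \<and> e j \<ge> 0
     then scale ((of_int (e i + e j) gchoose nat (e j)) * \<alpha> powi (e i) * \<beta> ^ nat (e j)) (Y u (e i + e j) w)
     else 0)"
proof -
  have "vop scale Y u (binom_pow \<alpha> i \<beta> j) e w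
      = scale (binom_pow \<alpha> i \<beta> j (e i + e j) e) (Y u (e i + e j) w)"
    unfolding vop_def by (rule Sum_any_single) (auto simp: binom_pow_def)
  then show ?thesis
    by (auto simp: binom_pow_def)
qed

definition prod_coeff :: "'v \<Rightarrow> 'v \<Rightarrow> 'v \<Rightarrow> int \<Rightarrow> int \<Rightarrow> 'v" where
  "prod_coeff u v w p q = Y u p (Y v q w)"

text \<open>
  The exponent of the variable of \<open>Y(u,x\<^sub>0)v\<close> is listed second, because it is the one that is
  bounded below uniformly.
\<close>

definition iter_coeff :: "'v \<Rightarrow> 'v \<Rightarrow> 'v \<Rightarrow> int \<Rightarrow> int \<Rightarrow> 'v" where
  "iter_coeff u v w q r = Y (Y u r v) q w"

lemma vop_prod_var_pow:
  assumes "i \<noteq> j"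
  shows "vop_prod scale Y u (var_pow i) v (var_pow j) w = bivariate i j (prod_coeff u v w)"
proof
  fix e :: "_ \<Rightarrow> int"
  let ?d = "\<lambda>k. if k = i then e i else 0"
  have "vop_prod scale Y u (var_pow i) v (var_pow j) w e
      = vop scale Y u (var_pow i) ?d (vop scale Y v (var_pow j) (e - ?d) w)"
    unfolding vop_prod_def
  proof (rule Sum_any_single)
    fix d
    assume "d \<noteq> ?d"
    then consider k where "k \<noteq> i" "d k \<noteq> 0" | "d i \<noteq> e i"
      by (auto simp: fun_eq_iff split: if_splits)
    then show "vop scale Y u (var_pow i) d (vop scale Y v (var_pow j) (e - d) w) = 0"
      using assms by cases (auto simp: vop_var_pow)
  qed
  moreover have "e - ?d = e(i := 0)"
    by (simp add: fun_eq_iff)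
  moreover have "vop scale Y v (var_pow j) (e(i := 0)) w
      = (if \<forall>k. k \<noteq> i \<and> k \<noteq> j \<longrightarrow> e k = 0 then Y v (e j) w else 0)"
    using assms by (auto simp: vop_var_pow)
  ultimately show "vop_prod scale Y u (var_pow i) v (var_pow j) w e = bivariate i j (prod_coeff u v w) e"
    by (auto simp: vop_var_pow bivariate_def prod_coeff_def)
qed

text \<open>
  In \<open>Y(u,\<alpha> x\<^sub>i + \<beta> x\<^sub>j)Y(v,x\<^sub>j)w\<close> all powers of \<open>x\<^sub>i\<close> come from the first factor, so only the splitting
  of the exponent of \<open>x\<^sub>j\<close> is summed over.
\<close>

lemma vop_prod_binom_pow:
  assumes "i \<noteq> j"
  shows "vop_prod scale Y u (binom_pow \<alpha> i \<beta> j) v (var_pow j) w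
       = bivariate i j (subst_binom \<alpha> \<beta> (prod_coeff u v w))"
proof
  fix e :: "_ \<Rightarrow> int"
  define h where "h = (\<lambda>c::nat. \<lambda>k. if k = i then e i else if k = j then int c else 0)"
  let ?t = "\<lambda>d. vop scale Y u (binom_pow \<alpha> i \<beta> j) d (vop scale Y v (var_pow j) (e - d) w)"
  have "inj h"
    using assms by (auto simp: inj_def h_def fun_eq_iff split: if_splits)
  moreover have "d \<in> range h" if "?t d \<noteq> 0" for d
  proof -
    have "vop scale Y v (var_pow j) (e - d) w \<noteq> 0"
      using that by (auto simp: vop_binom_pow split: if_splits)
    then have "d i = e i"
      using assms by (auto simp: vop_var_pow split: if_splits)
    moreover have "d j \<ge> 0" "\<forall>k. k \<noteq> i \<and> k \<noteq> j \<longrightarrow> d k = 0"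
      using that by (auto simp: vop_binom_pow split: if_splits)
    ultimately have "d = h (nat (d j))"
      by (auto simp: h_def fun_eq_iff)
    then show ?thesis
      by blast
  qed
  ultimately have "vop_prod scale Y u (binom_pow \<alpha> i \<beta> j) v (var_pow j) w e = Sum_any (\<lambda>c. ?t (h c))"
    unfolding vop_prod_def by (rule Sum_any_reindex_superset)
  moreover have "?t (h c) = (if \<forall>k. k \<noteq> i \<and> k \<noteq> j \<longrightarrow> e k = 0
      then scale ((of_int (e i + int c) gchoose c) * \<alpha> powi (e i) * \<beta> ^ c) (Y u (e i + int c) (Y v (e j - int c) w))
      else 0)" for c
  proof -
    have "e - h c = e(i := 0, j := e j - int c)"
      using assms by (simp add: fun_eq_iff h_def)
    moreover have "vop scale Y v (var_pow j) (e(i := 0, j := e j - int c)) w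
        = (if \<forall>k. k \<noteq> i \<and> k \<noteq> j \<longrightarrow> e k = 0 then Y v (e j - int c) w else 0)"
      using assms by (auto simp: vop_var_pow)
    moreover have "vop scale Y u (binom_pow \<alpha> i \<beta> j) (h c) x
        = scale ((of_int (e i + int c) gchoose c) * \<alpha> powi (e i) * \<beta> ^ c) (Y u (e i + int c) x)" for x
      using assms by (simp add: vop_binom_pow h_def)
    ultimately show ?thesis
      by (simp only: if_distrib[of "Y u (e i + int c)"] if_distrib[of "scale _"] Y_zero_right scale_zero_right)
  qed
  ultimately show "vop_prod scale Y u (binom_pow \<alpha> i \<beta> j) v (var_pow j) w e
      = bivariate i j (subst_binom \<alpha> \<beta> (prod_coeff u v w)) e"
    by (cases "\<forall>k. k \<noteq> i \<and> k \<noteq> j \<longrightarrow> e k = 0")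
      (simp_all add: bivariate_def subst_binom_def prod_coeff_def del: not_all)
qed

lemma vop_iter_eq:
  "vop_iter scale Y u i v P w e = Sum_any (\<lambda>p. vop scale Y (Y u p v) P (e(i := e i - p)) w)"
  by (simp add: vop_iter_def series_mult_var_pow)

lemma vop_iter_var_pow:
  assumes "i \<noteq> j"
  shows "vop_iter scale Y u i v (var_pow j) w = bivariate j i (iter_coeff u v w)"
proof
  fix e :: "_ \<Rightarrow> int"
  have "vop_iter scale Y u i v (var_pow j) w e = vop scale Y (Y u (e i) v) (var_pow j) (e(i := e i - e i)) w"
    unfolding vop_iter_eq by (rule Sum_any_single) (use assms in \<open>auto simp: vop_var_pow\<close>)
  then show "vop_iter scale Y u i v (var_pow j) w e = bivariate j i (iter_coeff u v w) e"
    using assms by (auto simp: vop_var_pow bivariate_def iter_coeff_def)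
qed

lemma vop_iter_binom_pow:
  assumes "i \<noteq> j"
  shows "vop_iter scale Y u j v (binom_pow \<alpha> i \<beta> j) w
       = bivariate i j (subst_binom \<alpha> \<beta> (iter_coeff u v w))"
proof
  fix e :: "_ \<Rightarrow> int"
  let ?t = "\<lambda>p. vop scale Y (Y u p v) (binom_pow \<alpha> i \<beta> j) (e(j := e j - p)) w"
  have "inj (\<lambda>c. e j - int c)"
    by (auto simp: inj_def)
  moreover have "p \<in> range (\<lambda>c. e j - int c)" if "?t p \<noteq> 0" for p
  proof -
    have "p = e j - int (nat (e j - p))"
      using that by (auto simp: vop_binom_pow split: if_splits)
    then show ?thesis
      by blast
  qed
  ultimately have "vop_iter scale Y u j v (binom_pow \<alpha> i \<beta> j) w e = Sum_any (\<lambda>c. ?t (e j - int c))"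
    unfolding vop_iter_eq by (rule Sum_any_reindex_superset)
  then show "vop_iter scale Y u j v (binom_pow \<alpha> i \<beta> j) w e
      = bivariate i j (subst_binom \<alpha> \<beta> (iter_coeff u v w)) e"
    by (cases "\<forall>k. k \<noteq> i \<and> k \<noteq> j \<longrightarrow> e k = 0")
      (use assms in \<open>simp_all add: vop_binom_pow bivariate_def subst_binom_def iter_coeff_def del: not_all\<close>)
qed

lemma prod_coeff_truncated: "\<exists>N. \<forall>u p. \<forall>q<N. prod_coeff u v w p q = 0"
proof -
  obtain N where "\<forall>q<N. Y v q w = 0"
    using truncation[of v w] unfolding lower_truncated_def by blast
  then show ?thesis
    by (intro exI[of _ N]) (simp add: prod_coeff_def)
qed

text \<open>
  The bound depends on \<open>u\<close> and \<open>v\<close> only.  This uniformity in \<open>w\<close> is what makes the exponent in weak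
  commutativity independent of the vector acted on.
\<close>

lemma iter_coeff_truncated: "\<exists>N. \<forall>w q. \<forall>r<N. iter_coeff u v w q r = 0"
proof -
  obtain N where "\<forall>r<N. Y u r v = 0"
    using truncation[of u v] unfolding lower_truncated_def by blast
  then show ?thesis
    by (intro exI[of _ N]) (simp add: iter_coeff_def)
qed

lemma truncated_prod_coeff: "truncated_in_second (prod_coeff u v w)"
  and truncated_iter_coeff: "truncated_in_second (iter_coeff u v w)"
  using prod_coeff_truncated[of v w] iter_coeff_truncated[of u v] unfolding truncated_in_second_def by blast+

end

section \<open>The defect of the Jacobi identity\<close>

lemma fvar_cases: "l = X1 \<or> l = X2 \<or> l = X0" "l = X2 \<or> l = X1 \<or> l = X0" "l = X2 \<or> l = X0 \<or> l = X1"
  by (cases l; simp)+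

lemma minus_one_powi: "(-1) powi (- 1 - n) = - ((-1::complex) powi n)"
proof -
  have "(-1) powi n * (-1) powi n = (1::complex)"
    by (simp flip: power_int_mult_distrib)
  moreover have "(-1) powi (- 1 - n) = (-1) powi (- 1) / ((-1::complex) powi n)"
    by (rule power_int_diff) simp
  ultimately show ?thesis
    by (simp add: eq_divide_eq divide_eq_eq)
qed

context vertex_operator_map
begin

text \<open>
  \<open>product_term + opposite_term - iterate_term\<close> is the left side of the Jacobi identity minus its
  right side.  The minus sign of the middle term of that identity is absorbed in
  \<open>(-1) powi a = - ((-1) powi (- 1 - a))\<close>, where the last power comes from \<open>(- x\<^sub>2 + x\<^sub>1)\<^sup>-\<^sup>1\<^sup>-\<^sup>a\<close>.
\<close>

definition product_term :: "'v \<Rightarrow> 'v \<Rightarrow> 'v \<Rightarrow> int \<Rightarrow> int \<Rightarrow> int \<Rightarrow> 'v" where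
  "product_term u v w a b c = delta_coeff 1 (prod_coeff u v w) a b c"

definition opposite_term :: "'v \<Rightarrow> 'v \<Rightarrow> 'v \<Rightarrow> int \<Rightarrow> int \<Rightarrow> int \<Rightarrow> 'v" where
  "opposite_term u v w a b c = scale ((-1) powi a) (delta_coeff 1 (prod_coeff v u w) a c b)"

definition iterate_term :: "'v \<Rightarrow> 'v \<Rightarrow> 'v \<Rightarrow> int \<Rightarrow> int \<Rightarrow> int \<Rightarrow> 'v" where
  "iterate_term u v w a b c = delta_coeff (-1) (iter_coeff u v w) b c a"

lemma product_term_recurrence:
  "product_term u v w (a - 1) b c = product_term u v w a (b - 1) c - product_term u v w a b (c - 1)"
  unfolding product_term_def
  using delta_coeff_recurrence[OF truncated_prod_coeff, of 1 u v w a b c] by simp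

lemma opposite_term_recurrence:
  "opposite_term u v w (a - 1) b c = opposite_term u v w a (b - 1) c - opposite_term u v w a b (c - 1)"
proof -
  have "(-1) powi (a - 1) = - ((-1::complex) powi a)"
    by (simp add: power_int_diff)
  then show ?thesis
    unfolding opposite_term_def
    using delta_coeff_recurrence[OF truncated_prod_coeff, of 1 v u w a c b]
    by (simp add: scale_right_diff_distrib)
qed

lemma iterate_term_recurrence:
  "iterate_term u v w (a - 1) b c = iterate_term u v w a (b - 1) c - iterate_term u v w a b (c - 1)"
  unfolding iterate_term_def using delta_coeff_recurrence[OF truncated_iter_coeff, of "-1" _ _ _ b c a] by simp

lemma product_term_below: "\<exists>N. \<forall>a b. \<forall>c<N. product_term u v w a b c = 0"
  using truncated_prod_coeff[of u v w] unfolding truncated_in_second_def product_term_def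
  by (elim exE) (blast intro: delta_coeff_below_truncation)

lemma opposite_term_below: "\<exists>N. \<forall>a. \<forall>b<N. \<forall>c. opposite_term u v w a b c = 0"
proof -
  obtain N where "\<forall>p. \<forall>q<N. prod_coeff v u w p q = 0"
    using truncated_prod_coeff[of v u w] unfolding truncated_in_second_def by blast
  then show ?thesis
    unfolding opposite_term_def by (intro exI[of _ N]) (simp add: delta_coeff_below_truncation)
qed

lemma iterate_term_below: "\<exists>N. \<forall>w. \<forall>a<N. \<forall>b c. iterate_term u v w a b c = 0"
proof -
  obtain N where N: "\<And>w. \<forall>q. \<forall>r<N. iter_coeff u v w q r = 0"
    using iter_coeff_truncated[of u v] by blast
  show ?thesis
    unfolding iterate_term_def by (intro exI[of _ N]) (simp add: delta_coeff_below_truncation[OF N])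
qed

definition defect :: "'v \<Rightarrow> 'v \<Rightarrow> 'v \<Rightarrow> int \<Rightarrow> int \<Rightarrow> int \<Rightarrow> 'v" where
  "defect u v w a b c = product_term u v w a b c + opposite_term u v w a b c - iterate_term u v w a b c"

lemma defect_recurrence:
  "defect u v w (a - 1) b c = defect u v w a (b - 1) c - defect u v w a b (c - 1)"
  by (simp add: defect_def product_term_recurrence opposite_term_recurrence iterate_term_recurrence algebra_simps)

lemma jacobi_identity_iff_defect:
  "jacobi_identity scale Y \<longleftrightarrow> (\<forall>u v w a b c. defect u v w a b c = 0)"
proof -
  have 1: "series_mult scale (delta_quot X0 (minus_pow X1 X2)) (vop_prod scale Y u (var_pow X1) v (var_pow X2) w) e
      = product_term u v w (e X0) (e X1) (e X2)" for u v w e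
  proof -
    have "series_mult scale (delta_quot X0 (minus_pow X1 X2)) (bivariate X1 X2 (prod_coeff u v w)) e
        = scale (1 powi (- 1 - e X0)) (delta_coeff 1 (prod_coeff u v w) (e X0) (e X1) (e X2))"
      by (rule series_mult_delta_quot_binom) (simp_all add: fvar_cases)
    then show ?thesis
      by (simp add: vop_prod_var_pow product_term_def)
  qed
  have 2: "series_mult scale (delta_quot X0 (neg_plus_pow X2 X1)) (vop_prod scale Y v (var_pow X2) u (var_pow X1) w) e
      = - opposite_term u v w (e X0) (e X1) (e X2)" for u v w e
  proof -
    have "series_mult scale (delta_quot X0 (neg_plus_pow X2 X1)) (bivariate X2 X1 (prod_coeff v u w)) e
        = scale ((-1) powi (- 1 - e X0)) (delta_coeff 1 (prod_coeff v u w) (e X0) (e X2) (e X1))"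
      by (rule series_mult_delta_quot_binom) (simp_all add: fvar_cases)
    then show ?thesis
      unfolding minus_one_powi opposite_term_def by (simp add: vop_prod_var_pow)
  qed
  have 3: "series_mult scale (delta_quot X1 (plus_pow X2 X0)) (vop_iter scale Y u X0 v (var_pow X2) w) e
      = iterate_term u v w (e X0) (e X1) (e X2)" for u v w e
  proof -
    have "series_mult scale (delta_quot X1 (plus_pow X2 X0)) (bivariate X2 X0 (iter_coeff u v w)) e
        = scale (1 powi (- 1 - e X1)) (delta_coeff (-1) (iter_coeff u v w) (e X1) (e X2) (e X0))"
      by (rule series_mult_delta_quot_binom) (simp_all add: fvar_cases)
    then show ?thesis
      by (simp add: vop_iter_var_pow iterate_term_def)
  qed
  have all: "(\<forall>e. Q (e X0) (e X1) (e X2)) \<longleftrightarrow> (\<forall>a b c. Q a b c)" for Q :: "int \<Rightarrow> int \<Rightarrow> int \<Rightarrow> bool"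
  proof (intro iffI allI)
    fix a b c
    assume "\<forall>e. Q (e X0) (e X1) (e X2)"
    from this[rule_format, of "\<lambda>l. case l of X0 \<Rightarrow> a | X1 \<Rightarrow> b | X2 \<Rightarrow> c"] show "Q a b c"
      by simp
  qed simp
  have "jacobi_identity scale Y \<longleftrightarrow> (\<forall>u v w e. product_term u v w (e X0) (e X1) (e X2)
      - - opposite_term u v w (e X0) (e X1) (e X2) = iterate_term u v w (e X0) (e X1) (e X2))"
    unfolding jacobi_identity_def fun_eq_iff minus_apply 1 2 3 ..
  also have "\<dots> \<longleftrightarrow> (\<forall>u v w a b c. product_term u v w a b c - - opposite_term u v w a b c = iterate_term u v w a b c)"
    using all[of "\<lambda>a b c. product_term u v w a b c - - opposite_term u v w a b c = iterate_term u v w a b c" for u v w]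
    by (intro iff_allI)
  finally show ?thesis
    by (simp add: defect_def)
qed

text \<open>
  The coefficient of \<open>x\<^sub>0\<^sup>-\<^sup>1\<^sup>-\<^sup>m\<close> in the two delta functions on the left of the Jacobi identity is
  \<open>(x\<^sub>1 - x\<^sub>2)\<^sup>m\<close> and \<open>(- x\<^sub>2 + x\<^sub>1)\<^sup>m\<close>, and these are equal for \<open>m \<ge> 0\<close>.
\<close>

lemma weak_commutativity_iff_term:
  "weak_commutativity scale Y \<longleftrightarrow>
    (\<forall>u v. \<exists>m::nat. \<forall>w b c. product_term u v w (- 1 - int m) b c + opposite_term u v w (- 1 - int m) b c = 0)"
proof -
  have "series_mult scale (minus_pow X1 X2 (int m))
         (vop_prod scale Y u (var_pow X1) v (var_pow X2) w - vop_prod scale Y v (var_pow X2) u (var_pow X1) w)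
      = bivariate X1 X2 (\<lambda>b c. product_term u v w (- 1 - int m) b c + opposite_term u v w (- 1 - int m) b c)" for u v w m
  proof -
    have "series_mult scale (minus_pow X1 X2 (int m)) (bivariate X1 X2 (prod_coeff u v w))
        = bivariate X1 X2 (\<lambda>b c. product_term u v w (- 1 - int m) b c)"
      by (rule trans, rule series_mult_binom_pow_delta_coeff[where s = 1]) (simp_all add: product_term_def)
    moreover have "series_mult scale (minus_pow X1 X2 (int m)) (bivariate X2 X1 (prod_coeff v u w))
        = bivariate X1 X2 (\<lambda>b c. - opposite_term u v w (- 1 - int m) b c)"
    proof -
      have "series_mult scale (neg_plus_pow X2 X1 (int m)) (bivariate X2 X1 (prod_coeff v u w))
          = bivariate X2 X1 (\<lambda>r t. scale ((-1) powi int m) (delta_coeff 1 (prod_coeff v u w) (- 1 - int m) r t))"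
        by (rule series_mult_binom_pow_delta_coeff) simp_all
      then show ?thesis
        unfolding opposite_term_def minus_one_powi binom_pow_swap[OF fvar.distinct(5)] bivariate_swap[of X1 X2]
        by simp
    qed
    ultimately show ?thesis
      by (simp add: series_mult_binom_pow_diff vop_prod_var_pow bivariate_diff)
  qed
  then show ?thesis
    by (simp add: weak_commutativity_def bivariate_eq_0_iff)
qed

text \<open>
  The product is handled by the substitution \<open>x\<^sub>1 = x\<^sub>0 + x\<^sub>2\<close>, the iterate by expanding
  \<open>(x\<^sub>0 + x\<^sub>2)\<^sup>m\<close> as \<open>(x\<^sub>2 + x\<^sub>0)\<^sup>m\<close>; both give the coefficient of \<open>x\<^sub>1\<^sup>-\<^sup>1\<^sup>-\<^sup>m\<close>.
\<close>

lemma weak_associativity_iff_term: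
  "weak_associativity scale Y \<longleftrightarrow>
    (\<forall>u v w. \<exists>m::nat. \<forall>a c. product_term u v w a (- 1 - int m) c - iterate_term u v w a (- 1 - int m) c = 0)"
proof -
  have "series_mult scale (plus_pow X0 X2 (int m))
         (vop_prod scale Y u (plus_pow X0 X2) v (var_pow X2) w - vop_iter scale Y u X0 v (var_pow X2) w)
      = bivariate X0 X2 (\<lambda>a c. product_term u v w a (- 1 - int m) c - iterate_term u v w a (- 1 - int m) c)" for u v w m
  proof -
    have "series_mult scale (plus_pow X0 X2 (int m)) (bivariate X0 X2 (subst_binom 1 1 (prod_coeff u v w)))
        = bivariate X0 X2 (\<lambda>a c. product_term u v w a (- 1 - int m) c)"
      by (rule trans, rule series_mult_binom_pow_subst) (simp_all add: product_term_def truncated_prod_coeff)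
    moreover have "series_mult scale (plus_pow X0 X2 (int m)) (bivariate X2 X0 (iter_coeff u v w))
        = bivariate X0 X2 (\<lambda>a c. iterate_term u v w a (- 1 - int m) c)"
      unfolding bivariate_swap[of X0 X2] binom_pow_swap[OF fvar.distinct(3)]
      by (rule trans, rule series_mult_binom_pow_delta_coeff[where s = "-1"]) (simp_all add: iterate_term_def)
    ultimately show ?thesis
      by (simp add: series_mult_binom_pow_diff vop_prod_binom_pow vop_iter_var_pow bivariate_diff)
  qed
  then show ?thesis
    by (simp add: weak_associativity_def bivariate_eq_0_iff)
qed

text \<open>
  Both series are substitutions \<open>x\<^sub>2 = x\<^sub>1 - x\<^sub>0\<close>, but expanded in opposite orders; multiplied by
  \<open>(x\<^sub>1 - x\<^sub>0)\<^sup>m\<close>, each gives the coefficient of \<open>x\<^sub>2\<^sup>-\<^sup>1\<^sup>-\<^sup>m\<close>.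
\<close>

lemma weak_skew_associativity_iff_term:
  "weak_skew_associativity scale Y \<longleftrightarrow>
    (\<forall>u v w. \<exists>m::nat. \<forall>a b. opposite_term u v w a b (- 1 - int m) - iterate_term u v w a b (- 1 - int m) = 0)"
proof -
  have "series_mult scale (minus_pow X1 X0 (int m))
         (vop_prod scale Y v (neg_plus_pow X0 X1) u (var_pow X1) w - vop_iter scale Y u X0 v (minus_pow X1 X0) w)
      = bivariate X0 X1 (\<lambda>a b. opposite_term u v w a b (- 1 - int m) - iterate_term u v w a b (- 1 - int m))" for u v w m
  proof -
    have "series_mult scale (minus_pow X1 X0 (int m)) (bivariate X0 X1 (subst_binom (-1) 1 (prod_coeff v u w)))
        = bivariate X0 X1 (\<lambda>a b. opposite_term u v w a b (- 1 - int m))"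
      unfolding binom_pow_swap[OF fvar.distinct(2)]
      by (rule trans, rule series_mult_binom_pow_subst) (simp_all add: opposite_term_def truncated_prod_coeff)
    moreover have "series_mult scale (minus_pow X1 X0 (int m)) (bivariate X1 X0 (subst_binom 1 (-1) (iter_coeff u v w)))
        = bivariate X0 X1 (\<lambda>a b. iterate_term u v w a b (- 1 - int m))"
      unfolding bivariate_swap[of X0 X1]
      by (rule trans, rule series_mult_binom_pow_subst) (simp_all add: iterate_term_def truncated_iter_coeff)
    ultimately show ?thesis
      by (simp add: series_mult_binom_pow_diff vop_prod_binom_pow vop_iter_binom_pow bivariate_diff)
  qed
  then show ?thesis
    by (simp add: weak_skew_associativity_def bivariate_eq_0_iff)
qed

lemma weak_commutativity_iff_defect:
  "weak_commutativity scale Y \<longleftrightarrow> (\<forall>u v. \<exists>M. \<forall>w. \<forall>a<M. \<forall>b c. defect u v w a b c = 0)"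
proof -
  have "(\<exists>m::nat. \<forall>w b c. product_term u v w (- 1 - int m) b c + opposite_term u v w (- 1 - int m) b c = 0)
      \<longleftrightarrow> (\<exists>M. \<forall>w. \<forall>a<M. \<forall>b c. defect u v w a b c = 0)" for u v
    unfolding defect_def
  proof (rule vanishing_layer_iff)
    fix w a b c
    assume 0: "product_term u v w a b c + opposite_term u v w a b c = 0" for b c
    have "product_term u v w (a - 1) b c + opposite_term u v w (a - 1) b c
        = (product_term u v w a (b - 1) c + opposite_term u v w a (b - 1) c)
        - (product_term u v w a b (c - 1) + opposite_term u v w a b (c - 1))"
      by (simp add: product_term_recurrence opposite_term_recurrence)
    then show "product_term u v w (a - 1) b c + opposite_term u v w (a - 1) b c = 0"
      by (simp add: 0)
  qed (rule iterate_term_below)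
  then show ?thesis
    by (simp add: weak_commutativity_iff_term)
qed

lemma weak_associativity_iff_defect:
  "weak_associativity scale Y \<longleftrightarrow> (\<forall>u v w. \<exists>M. \<forall>b<M. \<forall>a c. defect u v w a b c = 0)"
proof -
  have "(\<exists>m::nat. \<forall>a c. product_term u v w a (- 1 - int m) c - iterate_term u v w a (- 1 - int m) c = 0)
      \<longleftrightarrow> (\<exists>M. \<forall>b<M. \<forall>a c. defect u v w a b c = 0)" for u v w
  proof -
    \<comment> \<open>The exponent may depend on \<open>w\<close>, so the family is a single function.\<close>
    have "(\<exists>m::nat. \<forall>_::unit. \<forall>a c. product_term u v w a (- 1 - int m) c - iterate_term u v w a (- 1 - int m) c = 0)
      \<longleftrightarrow> (\<exists>M. \<forall>_::unit. \<forall>b<M. \<forall>a c. (product_term u v w a b c - iterate_term u v w a b c) - - opposite_term u v w a b c = 0)"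
    proof (rule vanishing_layer_iff)
      fix b a c
      assume 0: "product_term u v w a b c - iterate_term u v w a b c = 0" for a c
      have "product_term u v w a (b - 1) c - iterate_term u v w a (b - 1) c
          = (product_term u v w (a - 1) b c - iterate_term u v w (a - 1) b c)
          + (product_term u v w a b (c - 1) - iterate_term u v w a b (c - 1))"
        by (simp add: product_term_recurrence iterate_term_recurrence)
      then show "product_term u v w a (b - 1) c - iterate_term u v w a (b - 1) c = 0"
        by (simp add: 0)
    next
      show "\<exists>N. \<forall>_::unit. \<forall>b<N. \<forall>a c. - opposite_term u v w a b c = 0"
        using opposite_term_below[of u v w] by auto
    qed
    then show ?thesis
      by (simp add: defect_def algebra_simps)
  qed
  then show ?thesis
    by (simp add: weak_associativity_iff_term)
qed

lemma weak_skew_associativity_iff_defect: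
  "weak_skew_associativity scale Y \<longleftrightarrow> (\<forall>u v w. \<exists>M. \<forall>c<M. \<forall>a b. defect u v w a b c = 0)"
proof -
  have "(\<exists>m::nat. \<forall>a b. opposite_term u v w a b (- 1 - int m) - iterate_term u v w a b (- 1 - int m) = 0)
      \<longleftrightarrow> (\<exists>M. \<forall>c<M. \<forall>a b. defect u v w a b c = 0)" for u v w
  proof -
    have "(\<exists>m::nat. \<forall>_::unit. \<forall>a b. opposite_term u v w a b (- 1 - int m) - iterate_term u v w a b (- 1 - int m) = 0)
      \<longleftrightarrow> (\<exists>M. \<forall>_::unit. \<forall>c<M. \<forall>a b. (opposite_term u v w a b c - iterate_term u v w a b c) - - product_term u v w a b c = 0)"
    proof (rule vanishing_layer_iff)
      fix c a b
      assume 0: "opposite_term u v w a b c - iterate_term u v w a b c = 0" for a b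
      have "opposite_term u v w a b (c - 1) - iterate_term u v w a b (c - 1)
          = (opposite_term u v w a (b - 1) c - iterate_term u v w a (b - 1) c)
          - (opposite_term u v w (a - 1) b c - iterate_term u v w (a - 1) b c)"
        by (simp add: opposite_term_recurrence iterate_term_recurrence)
      then show "opposite_term u v w a b (c - 1) - iterate_term u v w a b (c - 1) = 0"
        by (simp add: 0)
    next
      show "\<exists>N. \<forall>_::unit. \<forall>c<N. \<forall>a b. - product_term u v w a b c = 0"
        using product_term_below[of u v w] by auto
    qed
    then show ?thesis
      by (simp add: defect_def algebra_simps)
  qed
  then show ?thesis
    by (simp add: weak_skew_associativity_iff_term)
qed

text \<open>
  Each pair of properties leaves one of the three coordinates of the defect free, and the recurrence is
  solved for the entry shifted in that coordinate.
\<close>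

lemma two_weak_properties_iff_jacobi:
  shows "weak_commutativity scale Y \<and> weak_associativity scale Y \<longleftrightarrow> jacobi_identity scale Y"
    and "weak_commutativity scale Y \<and> weak_skew_associativity scale Y \<longleftrightarrow> jacobi_identity scale Y"
    and "weak_associativity scale Y \<and> weak_skew_associativity scale Y \<longleftrightarrow> jacobi_identity scale Y"
proof -
  have J: "weak_commutativity scale Y \<and> weak_associativity scale Y \<and> weak_skew_associativity scale Y"
    if "jacobi_identity scale Y"
    using that unfolding weak_commutativity_iff_defect weak_associativity_iff_defect
      weak_skew_associativity_iff_defect jacobi_identity_iff_defect by simp
  have "jacobi_identity scale Y" if weak: "weak_commutativity scale Y" "weak_associativity scale Y"
    unfolding jacobi_identity_iff_defect
  proof (intro allI)
    fix u v w a b c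
    obtain M where M: "\<And>a b c. a < M \<Longrightarrow> defect u v w a b c = 0"
      using weak(1)[unfolded weak_commutativity_iff_defect, rule_format, of u v] by blast
    obtain N where N: "\<And>a b c. b < N \<Longrightarrow> defect u v w a b c = 0"
      using weak(2)[unfolded weak_associativity_iff_defect, rule_format, of u v w] by blast
    show "defect u v w a b c = 0"
    proof (rule vanishing_from_two_directions[where j = "\<lambda>a b c. defect u v w a b c" and M = M and N = N])
      show "defect u v w x y z = 0" if "defect u v w (x - 1) y (z + 1) = 0" "defect u v w x (y - 1) (z + 1) = 0" for x y z
        using that defect_recurrence[of u v w x y "z + 1"] by simp
    qed (simp_all add: M N)
  qed
  then show "weak_commutativity scale Y \<and> weak_associativity scale Y \<longleftrightarrow> jacobi_identity scale Y"
    using J by blast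
  have "jacobi_identity scale Y" if weak: "weak_commutativity scale Y" "weak_skew_associativity scale Y"
    unfolding jacobi_identity_iff_defect
  proof (intro allI)
    fix u v w a b c
    obtain M where M: "\<And>a b c. a < M \<Longrightarrow> defect u v w a b c = 0"
      using weak(1)[unfolded weak_commutativity_iff_defect, rule_format, of u v] by blast
    obtain N where N: "\<And>a b c. c < N \<Longrightarrow> defect u v w a b c = 0"
      using weak(2)[unfolded weak_skew_associativity_iff_defect, rule_format, of u v w] by blast
    show "defect u v w a b c = 0"
    proof (rule vanishing_from_two_directions[where j = "\<lambda>a c b. defect u v w a b c" and M = M and N = N])
      show "defect u v w x z y = 0" if "defect u v w (x - 1) (z + 1) y = 0" "defect u v w x (z + 1) (y - 1) = 0" for x y z
        using that defect_recurrence[of u v w x "z + 1" y] by simp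
    qed (simp_all add: M N)
  qed
  then show "weak_commutativity scale Y \<and> weak_skew_associativity scale Y \<longleftrightarrow> jacobi_identity scale Y"
    using J by blast
  have "jacobi_identity scale Y" if weak: "weak_associativity scale Y" "weak_skew_associativity scale Y"
    unfolding jacobi_identity_iff_defect
  proof (intro allI)
    fix u v w a b c
    obtain M where M: "\<And>a b c. b < M \<Longrightarrow> defect u v w a b c = 0"
      using weak(1)[unfolded weak_associativity_iff_defect, rule_format, of u v w] by blast
    obtain N where N: "\<And>a b c. c < N \<Longrightarrow> defect u v w a b c = 0"
      using weak(2)[unfolded weak_skew_associativity_iff_defect, rule_format, of u v w] by blast
    show "defect u v w a b c = 0"
    proof (rule vanishing_from_two_directions[where j = "\<lambda>b c a. defect u v w a b c" and M = M and N = N])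
      show "defect u v w z x y = 0" if "defect u v w (z + 1) (x - 1) y = 0" "defect u v w (z + 1) x (y - 1) = 0" for x y z
        using that defect_recurrence[of u v w "z + 1" x y] by simp
    qed (simp_all add: M N)
  qed
  then show "weak_associativity scale Y \<and> weak_skew_associativity scale Y \<longleftrightarrow> jacobi_identity scale Y"
    using J by blast
qed

end

theorem proposition4p2:
  fixes scale :: "complex \<Rightarrow> 'v::ab_group_add \<Rightarrow> 'v"
    and Y :: "'v \<Rightarrow> int \<Rightarrow> 'v \<Rightarrow> 'v"
  assumes "vertex_operator_map scale Y"
  shows "(weak_commutativity scale Y \<and> weak_associativity scale Y \<longleftrightarrow> jacobi_identity scale Y)
    \<and> (weak_commutativity scale Y \<and> weak_skew_associativity scale Y \<longleftrightarrow> jacobi_identity scale Y)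
    \<and> (weak_associativity scale Y \<and> weak_skew_associativity scale Y \<longleftrightarrow> jacobi_identity scale Y)"
proof -
  interpret vertex_operator_map scale Y
    by (rule assms)
  show ?thesis
    by (intro conjI two_weak_properties_iff_jacobi)
qed

end
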